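(* Let $(\mathrm{A},.)$ be a finite dimensional symmetric Leibniz algebra over a field of characteristic $0$, and let $[u,v]=u.v-v.u$. Then $(\mathrm{A},.)$ is Poisson admissible, the product "$.$" is strongly quasi-canonical on the Lie algebra $(\mathrm{A},[\,,\,])$, and it has parallel curvature.
   Context: For an algebra $(\mathrm{A},.)$ put $\mathrm{L}_uv=u.v$ and $\mathrm{R}_uv=v.u$. $(\mathrm{A},.)$ is a symmetric Leibniz algebra if for every $u\in\mathrm{A}$ both $\mathrm{L}_u$ and $\mathrm{R}_u$ are derivations of $(\mathrm{A},.)$. A Poisson algebra is a finite dimensional Lie algebra $(\mathfrak{g},[\,,\,])$ endowed with a commutative and associative product $\circ$ such that $[u,v\circ w]=[u,v]\circ w+v\circ[u,w]$. An algebra $(\mathrm{A},.)$ is Poisson admissible if $(\mathrm{A},[\,,\,],\circ)$ is a Poisson algebra, where $[u,v]=u.v-v.u$ and $u\circ v=\frac12(u.v+v.u)$. Let $\mathfrak{g}$ be a finite dimensional Lie algebra and $\alpha$ a bilinear product on $\mathfrak{g}$, with $\mathrm{L}_uv=\alpha(u,v)$, and curvature $K^\alpha(u,v)=[\mathrm{L}_u,\mathrm{L}_v]-\mathrm{L}_{[u,v]}$. The product $\alpha$ is quasi-canonical if it is Lie-admissible ($\alpha(u,v)-\alpha(v,u)=[u,v]$), bi-invariant ($[u,\alpha(v,w)]=\alpha([u,v],w)+\alpha(v,[u,w])$), and $K^\alpha(u,v)=-\frac14\mathrm{ad}_{[u,v]}$, for all $u,v,w$. Its holonomy Lie algebra is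 then $\mathfrak{h}^\alpha=\mathrm{ad}_{[\mathfrak{g},\mathfrak{g}]}+\mathrm{L}_{[\mathfrak{g},[\mathfrak{g},\mathfrak{g}]]}\subset\mathrm{End}(\mathfrak{g})$, and $\alpha$ is strongly quasi-canonical if it is quasi-canonical and $\mathfrak{h}^\alpha=\mathrm{ad}_{[\mathfrak{g},\mathfrak{g}]}$. The product $\alpha$ has parallel curvature if $[\mathrm{L}_u,K^\alpha(v,w)]-K^\alpha(\alpha(u,v),w)-K^\alpha(v,\alpha(u,w))=0$ for all $u,v,w\in\mathfrak{g}$. *)

theory Defs
  imports Complex_Main
begin

text \<open>
  A vector space is given by its scalar multiplication \<open>s\<close>; its carrier is the whole type \<open>'a\<close>.
  Endomorphisms are functions \<open>'a \<Rightarrow> 'a\<close>, and for a product \<open>p\<close> the left multiplication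
  \<open>L\<^sub>u\<close> is the partial application \<open>p u\<close>; in particular \<open>ad\<^sub>u\<close> is \<open>br u\<close> for a bracket \<open>br\<close>.
\<close>

definition finite_dimensional :: "('k::field \<Rightarrow> 'a::ab_group_add \<Rightarrow> 'a) \<Rightarrow> bool" where
  "finite_dimensional s \<longleftrightarrow> (\<exists>B. finite_dimensional_vector_space s B)"

definition bilinear_product ::
    "('k::field \<Rightarrow> 'a::ab_group_add \<Rightarrow> 'a) \<Rightarrow> ('a \<Rightarrow> 'a \<Rightarrow> 'a) \<Rightarrow> bool" where
  "bilinear_product s p \<longleftrightarrow>
     (\<forall>u. Vector_Spaces.linear s s (\<lambda>v. p u v)) \<and> (\<forall>v. Vector_Spaces.linear s s (\<lambda>u. p u v))"

definition derivation ::
    "('k::field \<Rightarrow> 'a::ab_group_add \<Rightarrow> 'a) \<Rightarrow> ('a \<Rightarrow> 'a \<Rightarrow> 'a) \<Rightarrow> ('a \<Rightarrow> 'a) \<Rightarrow> bool" where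
  "derivation s p D \<longleftrightarrow>
     Vector_Spaces.linear s s D \<and> (\<forall>v w. D (p v w) = p (D v) w + p v (D w))"

definition symmetric_leibniz_algebra ::
    "('k::field \<Rightarrow> 'a::ab_group_add \<Rightarrow> 'a) \<Rightarrow> ('a \<Rightarrow> 'a \<Rightarrow> 'a) \<Rightarrow> bool" where
  "symmetric_leibniz_algebra s p \<longleftrightarrow>
     bilinear_product s p \<and>
     (\<forall>u. derivation s p (\<lambda>v. p u v) \<and> derivation s p (\<lambda>v. p v u))"

definition lie_algebra ::
    "('k::field \<Rightarrow> 'a::ab_group_add \<Rightarrow> 'a) \<Rightarrow> ('a \<Rightarrow> 'a \<Rightarrow> 'a) \<Rightarrow> bool" where
  "lie_algebra s br \<longleftrightarrow>
     bilinear_product s br \<and>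
     (\<forall>u. br u u = 0) \<and>
     (\<forall>u v w. br u (br v w) + br v (br w u) + br w (br u v) = 0)"

definition poisson_algebra ::
    "('k::field \<Rightarrow> 'a::ab_group_add \<Rightarrow> 'a) \<Rightarrow> ('a \<Rightarrow> 'a \<Rightarrow> 'a) \<Rightarrow> ('a \<Rightarrow> 'a \<Rightarrow> 'a) \<Rightarrow> bool" where
  "poisson_algebra s br c \<longleftrightarrow>
     finite_dimensional s \<and> lie_algebra s br \<and> bilinear_product s c \<and>
     (\<forall>u v. c u v = c v u) \<and>
     (\<forall>u v w. c (c u v) w = c u (c v w)) \<and>
     (\<forall>u v w. br u (c v w) = c (br u v) w + c v (br u w))"

definition commutator :: "('a::ab_group_add \<Rightarrow> 'a \<Rightarrow> 'a) \<Rightarrow> 'a \<Rightarrow> 'a \<Rightarrow> 'a" where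
  "commutator p u v = p u v - p v u"

definition symmetrized ::
    "('k::field \<Rightarrow> 'a::ab_group_add \<Rightarrow> 'a) \<Rightarrow> ('a \<Rightarrow> 'a \<Rightarrow> 'a) \<Rightarrow> 'a \<Rightarrow> 'a \<Rightarrow> 'a" where
  "symmetrized s p u v = s (1 / 2) (p u v + p v u)"

definition poisson_admissible ::
    "('k::field \<Rightarrow> 'a::ab_group_add \<Rightarrow> 'a) \<Rightarrow> ('a \<Rightarrow> 'a \<Rightarrow> 'a) \<Rightarrow> bool" where
  "poisson_admissible s p \<longleftrightarrow>
     bilinear_product s p \<and> poisson_algebra s (commutator p) (symmetrized s p)"

definition End_bracket :: "('a::ab_group_add \<Rightarrow> 'a) \<Rightarrow> ('a \<Rightarrow> 'a) \<Rightarrow> 'a \<Rightarrow> 'a" where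
  "End_bracket f g x = f (g x) - g (f x)"

definition curvature ::
    "('a::ab_group_add \<Rightarrow> 'a \<Rightarrow> 'a) \<Rightarrow> ('a \<Rightarrow> 'a \<Rightarrow> 'a) \<Rightarrow> 'a \<Rightarrow> 'a \<Rightarrow> 'a \<Rightarrow> 'a" where
  "curvature br \<alpha> u v x = End_bracket (\<alpha> u) (\<alpha> v) x - \<alpha> (br u v) x"

definition quasi_canonical ::
    "('k::field \<Rightarrow> 'a::ab_group_add \<Rightarrow> 'a) \<Rightarrow> ('a \<Rightarrow> 'a \<Rightarrow> 'a) \<Rightarrow> ('a \<Rightarrow> 'a \<Rightarrow> 'a) \<Rightarrow> bool" where
  "quasi_canonical s br \<alpha> \<longleftrightarrow>
     finite_dimensional s \<and> lie_algebra s br \<and> bilinear_product s \<alpha> \<and>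
     (\<forall>u v. \<alpha> u v - \<alpha> v u = br u v) \<and>
     (\<forall>u v w. br u (\<alpha> v w) = \<alpha> (br u v) w + \<alpha> v (br u w)) \<and>
     (\<forall>u v. curvature br \<alpha> u v = (\<lambda>x. s (- (1 / 4)) (br (br u v) x)))"

text \<open>The subspace \<open>[S, T]\<close> is the linear span of the brackets, not just the set of brackets.\<close>

definition bracket_space ::
    "('k::field \<Rightarrow> 'a::ab_group_add \<Rightarrow> 'a) \<Rightarrow> ('a \<Rightarrow> 'a \<Rightarrow> 'a) \<Rightarrow> 'a set \<Rightarrow> 'a set \<Rightarrow> 'a set" where
  "bracket_space s br S T = module.span s {br u v | u v. u \<in> S \<and> v \<in> T}"

definition ad_derived ::
    "('k::field \<Rightarrow> 'a::ab_group_add \<Rightarrow> 'a) \<Rightarrow> ('a \<Rightarrow> 'a \<Rightarrow> 'a) \<Rightarrow> ('a \<Rightarrow> 'a) set" where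
  "ad_derived s br = br ` bracket_space s br UNIV UNIV"

definition holonomy ::
    "('k::field \<Rightarrow> 'a::ab_group_add \<Rightarrow> 'a) \<Rightarrow> ('a \<Rightarrow> 'a \<Rightarrow> 'a) \<Rightarrow> ('a \<Rightarrow> 'a \<Rightarrow> 'a) \<Rightarrow> ('a \<Rightarrow> 'a) set" where
  "holonomy s br \<alpha> =
     {\<lambda>w. f w + \<alpha> y w | f y.
        f \<in> ad_derived s br \<and> y \<in> bracket_space s br UNIV (bracket_space s br UNIV UNIV)}"

definition strongly_quasi_canonical ::
    "('k::field \<Rightarrow> 'a::ab_group_add \<Rightarrow> 'a) \<Rightarrow> ('a \<Rightarrow> 'a \<Rightarrow> 'a) \<Rightarrow> ('a \<Rightarrow> 'a \<Rightarrow> 'a) \<Rightarrow> bool" where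
  "strongly_quasi_canonical s br \<alpha> \<longleftrightarrow>
     quasi_canonical s br \<alpha> \<and> holonomy s br \<alpha> = ad_derived s br"

definition parallel_curvature ::
    "('a::ab_group_add \<Rightarrow> 'a \<Rightarrow> 'a) \<Rightarrow> ('a \<Rightarrow> 'a \<Rightarrow> 'a) \<Rightarrow> bool" where
  "parallel_curvature br \<alpha> \<longleftrightarrow>
     (\<forall>u v w x. End_bracket (\<alpha> u) (curvature br \<alpha> v w) x
        - curvature br \<alpha> (\<alpha> u v) w x - curvature br \<alpha> v (\<alpha> u w) x = 0)"

end

theory Submission
  imports Defs
begin

text \<open>
  Writing \<open>\<circ>\<close> for the symmetrized product, the two Leibniz rules give
  \<open>L\<^bsub>u\<circ>v\<^esub> = R\<^bsub>u\<circ>v\<^esub> = 0\<close>, and comparing them gives \<open>(u.v)\<circ>w = 0\<close>. Hence all iterated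
  products involving \<open>\<circ>\<close> vanish, and \<open>L\<^sub>y = ad\<^bsub>y/2\<^esub>\<close> for every \<open>y\<close> in the derived algebra.
  Since \<open>[L\<^sub>u, L\<^sub>v] = L\<^bsub>u.v\<^esub>\<close>, the curvature is \<open>K(u,v) = - L\<^bsub>u.v\<^esub>\<close>, which is parallel because
  \<open>L\<^sub>u\<close> is a derivation.
\<close>

locale symmetric_leibniz = vector_space scale
  for scale :: "'k::field_char_0 \<Rightarrow> 'a::ab_group_add \<Rightarrow> 'a" +
  fixes mul :: "'a \<Rightarrow> 'a \<Rightarrow> 'a"
  assumes symmetric_leibniz: "symmetric_leibniz_algebra scale mul"
begin

abbreviation br :: "'a \<Rightarrow> 'a \<Rightarrow> 'a" where
  "br \<equiv> commutator mul"

lemma bilinear: "bilinear_product scale mul"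
  using symmetric_leibniz by (simp add: symmetric_leibniz_algebra_def)

lemma linear_left: "Vector_Spaces.linear scale scale (\<lambda>u. mul u v)"
  and linear_right: "Vector_Spaces.linear scale scale (\<lambda>v. mul u v)"
  using bilinear by (simp_all add: bilinear_product_def)

lemma mul_add_left: "mul (u + v) w = mul u w + mul v w"
  and mul_add_right: "mul w (u + v) = mul w u + mul w v"
  and mul_diff_left: "mul (u - v) w = mul u w - mul v w"
  and mul_diff_right: "mul w (u - v) = mul w u - mul w v"
  and mul_zero_left: "mul 0 w = 0"
  and mul_zero_right: "mul w 0 = 0"
  and mul_scale_left: "mul (scale c u) w = scale c (mul u w)"
  and mul_scale_right: "mul w (scale c u) = scale c (mul w u)"
  by (fact module_hom.add[OF Vector_Spaces.linear.axioms(3)[OF linear_left]]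
      module_hom.add[OF Vector_Spaces.linear.axioms(3)[OF linear_right]]
      module_hom.diff[OF Vector_Spaces.linear.axioms(3)[OF linear_left]]
      module_hom.diff[OF Vector_Spaces.linear.axioms(3)[OF linear_right]]
      module_hom.zero[OF Vector_Spaces.linear.axioms(3)[OF linear_left]]
      module_hom.zero[OF Vector_Spaces.linear.axioms(3)[OF linear_right]]
      module_hom.scale[OF Vector_Spaces.linear.axioms(3)[OF linear_left]]
      module_hom.scale[OF Vector_Spaces.linear.axioms(3)[OF linear_right]])+

lemmas mul_simps = mul_add_left mul_add_right mul_diff_left mul_diff_right
  mul_zero_left mul_zero_right mul_scale_left mul_scale_right

lemma linearI:
  assumes "\<And>u v. f (u + v) = f u + f v" "\<And>c u. f (scale c u) = scale c (f u)"
  shows "Vector_Spaces.linear scale scale f"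
  by unfold_locales (use assms in auto)

lemma bilinear_commutator: "bilinear_product scale br"
  unfolding bilinear_product_def commutator_def
  by (intro conjI allI linearI) (simp_all add: mul_simps algebra_simps)

lemma bilinear_symmetrized: "bilinear_product scale (symmetrized scale mul)"
  unfolding bilinear_product_def symmetrized_def
  by (intro conjI allI linearI) (simp_all add: mul_simps algebra_simps)

lemma left_leibniz: "mul u (mul v w) = mul (mul u v) w + mul v (mul u w)"
  and right_leibniz: "mul (mul v w) u = mul (mul v u) w + mul v (mul w u)"
  using symmetric_leibniz unfolding symmetric_leibniz_algebra_def derivation_def by blast+

text \<open>Since \<open>L_u\<close> is a derivation, \<open>L_{u.v}\<close> is the operator
  commutator of \<open>L_u\<close> and \<open>L_v\<close>. This form makes antisymmetry in
  \<open>u\<close>, \<open>v\<close> visible.\<close>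

lemma left_mul_eq: "mul (mul u v) w = mul u (mul v w) - mul v (mul u w)"
  by (subst left_leibniz) simp

lemma right_mul_eq: "mul w (mul u v) = mul (mul w u) v - mul (mul w v) u"
  by (subst right_leibniz) simp

lemma mul_anticommute_left: "mul (mul v u) w = - mul (mul u v) w"
  by (simp add: left_mul_eq)

lemma mul_anticommute_right: "mul w (mul v u) = - mul w (mul u v)"
  by (simp add: right_mul_eq)

text \<open>This is where the left and right rules meet: expand \<open>mul (mul u v) w\<close> by
  the right rule and its first summand by the left one. Antisymmetry then cancels the
  \<open>u.(v.w)\<close> terms.\<close>

lemma mul_product_anticommute: "mul w (mul u v) = - mul (mul u v) w"
proof -
  have "mul (mul u v) w = mul (mul u w) v + mul u (mul v w)"
    by (rule right_leibniz)
  also have "\<dots> = - mul w (mul u v)"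
    by (simp add: left_mul_eq[of u w v] mul_anticommute_right[of u w v])
  finally show ?thesis by simp
qed

lemma symmetrized_annihilates:
  "mul (symmetrized scale mul u v) w = 0" "mul w (symmetrized scale mul u v) = 0"
  using mul_anticommute_left[of v u w] mul_anticommute_right[of w v u]
  by (simp_all add: symmetrized_def mul_simps)

text \<open>\<open>ad_u\<close> is the difference \<open>L_u - R_u\<close> of two
  derivations.\<close>

lemma commutator_derivation:
  "br u (mul v w) = mul (br u v) w + mul v (br u w)"
  by (simp add: commutator_def mul_simps left_leibniz[of u v w] right_leibniz[of v w u])

lemma lie_algebra_commutator: "lie_algebra scale br"
proof -
  have "br u (br v w) + br v (br w u) + br w (br u v) = 0" for u v w
  proof -
    \<comment> \<open>Being a derivation of \<open>mul\<close>, \<open>ad_u\<close> is one of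
      \<open>br\<close>; with antisymmetry this is the Jacobi identity.\<close>
    have "br u (br v w) = br u (mul v w) - br u (mul w v)"
      by (simp add: commutator_def mul_simps)
    then show ?thesis
      by (simp add: commutator_derivation) (simp add: commutator_def mul_simps)
  qed
  then show ?thesis
    unfolding lie_algebra_def using bilinear_commutator by (simp add: commutator_def)
qed

lemma poisson_admissible_mul:
  assumes "finite_dimensional scale"
  shows "poisson_admissible scale mul"
proof -
  let ?c = "symmetrized scale mul"
  have comm: "?c u v = ?c v u" for u v
    by (simp add: symmetrized_def add.commute)
  \<comment> \<open>Only the outer products are unfolded: the inner ones annihilate everything, so
    both sides are 0.\<close>
  have "?c (?c u v) w = ?c u (?c v w)" for u v w
    by (simp add: symmetrized_def[of _ _ "?c u v"] symmetrized_def[of _ _ u "?c v w"]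
        symmetrized_annihilates)
  moreover have "br u (?c v w) = ?c (br u v) w + ?c v (br u w)" for u v w
  proof -
    have "br u (?c v w) = scale (1 / 2) (br u (mul v w) + br u (mul w v))"
      by (simp add: symmetrized_def commutator_def mul_simps algebra_simps)
    then show ?thesis
      by (simp add: commutator_derivation symmetrized_def algebra_simps)
  qed
  ultimately show ?thesis
    unfolding poisson_admissible_def poisson_algebra_def
    using assms bilinear lie_algebra_commutator bilinear_symmetrized comm by blast
qed

lemma mul_commutator: "mul (br u v) x = scale 2 (mul (mul u v) x)"
  using mul_anticommute_left[of v u x] scale_left_distrib[of 1 1 "mul (mul u v) x"]
  by (simp add: commutator_def mul_simps)

text \<open>The commutator of \<open>L_u\<close> and \<open>L_v\<close> is \<open>L_{u.v}\<close>,
  whereas \<open>L_{[u,v]}\<close> is twice that.\<close>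

lemma curvature_eq: "curvature br mul u v x = - mul (mul u v) x"
  by (simp add: curvature_def End_bracket_def commutator_def mul_simps
      left_leibniz[of u v x] mul_anticommute_left[of v u x])

text \<open>The condition is linear in \<open>y\<close>, so it passes from commutators, which are
  differences of products, to their span.\<close>

lemma derived_anticommute:
  assumes "y \<in> bracket_space scale br UNIV UNIV"
  shows "mul x y = - mul y x"
proof -
  have "subspace {y. mul x y = - mul y x}"
    by (auto simp: subspace_def mul_simps)
  moreover have "{br u v | u v. u \<in> UNIV \<and> v \<in> UNIV} \<subseteq> {y. mul x y = - mul y x}"
    by (auto simp: commutator_def mul_simps mul_product_anticommute)
  ultimately show ?thesis
    using span_minimal assms unfolding bracket_space_def by blast
qed

lemma mul_eq_commutator_half:
  assumes "y \<in> bracket_space scale br UNIV UNIV"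
  shows "mul y x = br (scale (1 / 2) y) x"
  using derived_anticommute[OF assms, of x] scale_left_distrib[of "1/2" "1/2" "mul y x"]
  by (simp add: commutator_def mul_simps)

lemma commutator_in_derived: "br u v \<in> bracket_space scale br UNIV UNIV"
  unfolding bracket_space_def by (rule span_base) auto

text \<open>On the derived algebra \<open>ad\<close> is twice \<open>L\<close>, so
  \<open>ad_{[u,v]} = 2 L_{[u,v]} = 4 L_{u.v}\<close>; this is the source of the factor 1/4.\<close>

lemma quasi_canonical_mul:
  assumes "finite_dimensional scale"
  shows "quasi_canonical scale br mul"
proof -
  have "curvature br mul u v x = scale (- (1 / 4)) (br (br u v) x)" for u v x
  proof -
    have "br (br u v) x = scale 2 (mul (br u v) x)"
      using derived_anticommute[OF commutator_in_derived, of x u v]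
        scale_left_distrib[of 1 1 "mul (br u v) x"]
      by (simp add: commutator_def[of mul "br u v"])
    then show ?thesis
      by (simp add: curvature_eq mul_commutator)
  qed
  then show ?thesis
    unfolding quasi_canonical_def
    using assms bilinear lie_algebra_commutator commutator_derivation
    by (auto simp: commutator_def)
qed

lemma holonomy_eq: "holonomy scale br mul = ad_derived scale br"
proof
  let ?D = "bracket_space scale br UNIV UNIV"
  have "bracket_space scale br UNIV ?D \<subseteq> ?D"
    unfolding bracket_space_def by (rule span_mono) auto
  moreover have "(\<lambda>w. br z w + mul y w) \<in> br ` ?D" if "z \<in> ?D" "y \<in> ?D" for y z
  proof
    \<comment> \<open>The witness absorbs \<open>L_y\<close>, which equals \<open>ad\<close> of half
      of \<open>y\<close>.\<close>
    show "(\<lambda>w. br z w + mul y w) = br (z + scale (1 / 2) y)"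
      unfolding mul_eq_commutator_half[OF that(2)]
      by (rule ext) (simp add: commutator_def mul_simps)
    show "z + scale (1 / 2) y \<in> ?D"
      using that unfolding bracket_space_def by (intro span_add span_scale)
  qed
  ultimately show "holonomy scale br mul \<subseteq> ad_derived scale br"
    unfolding holonomy_def ad_derived_def by blast
  show "ad_derived scale br \<subseteq> holonomy scale br mul"
  proof
    fix f assume "f \<in> ad_derived scale br"
    moreover have "0 \<in> bracket_space scale br UNIV ?D"
      unfolding bracket_space_def by (rule span_zero)
    moreover have "f = (\<lambda>w. f w + mul 0 w)"
      by (simp add: mul_simps)
    ultimately show "f \<in> holonomy scale br mul"
      unfolding holonomy_def by blast
  qed
qed

text \<open>After \<open>curvature_eq\<close> the claim is that bracketing \<open>L_{v.w}\<close>
  with \<open>L_u\<close> gives \<open>L_{u.(v.w)}\<close>, and that \<open>u.(v.w)\<close> splits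
  by the left Leibniz rule.\<close>

lemma parallel_curvature_mul: "parallel_curvature br mul"
  unfolding parallel_curvature_def End_bracket_def curvature_eq
proof (intro allI)
  fix u v w x
  have "mul u (- mul (mul v w) x) = - mul u (mul (mul v w) x)"
    using mul_diff_right[of u 0 "mul (mul v w) x"] by (simp add: mul_zero_right)
  then show "mul u (- mul (mul v w) x) - - mul (mul v w) (mul u x)
      - - mul (mul (mul u v) w) x - - mul (mul v (mul u w)) x = 0"
    using left_leibniz[of u "mul v w" x]
    by (simp add: left_leibniz[of u v w] mul_add_left)
qed

end

theorem theorem3p1:
  fixes scale :: "'k::field_char_0 \<Rightarrow> 'a::ab_group_add \<Rightarrow> 'a"
    and mul :: "'a \<Rightarrow> 'a \<Rightarrow> 'a"
  assumes "finite_dimensional scale"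
    and "symmetric_leibniz_algebra scale mul"
  shows "poisson_admissible scale mul
    \<and> strongly_quasi_canonical scale (commutator mul) mul
    \<and> parallel_curvature (commutator mul) mul"
proof -
  \<comment> \<open>The vector space axioms required by the locale are read off from finite
    dimensionality.\<close>
  have "vector_space scale"
    using assms(1) unfolding finite_dimensional_def
    by (auto dest: finite_dimensional_vector_space.axioms(1))
  then interpret symmetric_leibniz scale mul
    using assms(2) by (simp add: symmetric_leibniz_def symmetric_leibniz_axioms_def)
  show ?thesis
    using poisson_admissible_mul[OF assms(1)] quasi_canonical_mul[OF assms(1)]
      holonomy_eq parallel_curvature_mul
    by (simp add: strongly_quasi_canonical_def)
qed

end
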